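(* Let $\mathbb{K}$ be either $\mathbb{R}$ or $\mathbb{C}$, let $X$ be a Banach space over $\mathbb{K}$, and let $x, y \in X$ with $x \neq 0$. Then $x$ is Birkhoff-James orthogonal to $y$ (that is, $\|x + \lambda y\| \geq \|x\|$ for all $\lambda \in \mathbb{K}$) if and only if there exists a semi-inner product $\varphi : X \oplus_{\infty} X \rightarrow \mathbb{K}$ such that $\|\varphi\| = 1$, $\varphi(x,x) = \|x\|^2$ and $\varphi(x,y) = 0$.
   Context: For Banach spaces $X$ and $Y$ over $\mathbb{K}$, $X \oplus_{\infty} Y$ denotes the Banach space $X \times Y$ with the norm $\|(x,y)\|_{\infty} = \max\{\|x\|_X, \|y\|_Y\}$. A semi-inner product on a vector space $V$ over $\mathbb{K}$ is a function $\varphi : V \times V \rightarrow \mathbb{K}$ such that for all $x,y,z \in V$ and $\alpha,\beta \in \mathbb{K}$: (a) $\varphi(\alpha x + \beta y, z) = \alpha \varphi(x,z) + \beta \varphi(y,z)$; (b) $\varphi(x,y) = \overline{\varphi(y,x)}$; (c) $\varphi(x,x) \geq 0$. A semi-inner product $\varphi : X \oplus_{\infty} X \rightarrow \mathbb{K}$ means a semi-inner product on the vector space $X$, viewed as a sesquilinear map on $X \times X$. Its norm is $\|\varphi\| = \sup\{|\varphi(u,v)| : u, v \in X, \|u\| \leq 1, \|v\| \leq 1\}$. *)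

theory Defs
  imports "HOL-Analysis.Analysis"
begin

text \<open>
  Real Banach spaces are the types of class \<^class>\<open>banach\<close>.  The distribution has no complex
  counterpart, so a complex Banach space is a real one with a compatible complex scalar
  multiplication.  The unit law follows from \<open>scaleC_of_real\<close>.
\<close>

class complex_banach = banach +
  fixes scaleC :: "complex \<Rightarrow> 'a \<Rightarrow> 'a"  (infixr "*\<^sub>C" 75)
  assumes scaleC_add_right: "a *\<^sub>C (x + y) = a *\<^sub>C x + a *\<^sub>C y"
    and scaleC_add_left: "(a + b) *\<^sub>C x = a *\<^sub>C x + b *\<^sub>C x"
    and scaleC_scaleC: "a *\<^sub>C (b *\<^sub>C x) = (a * b) *\<^sub>C x"
    and scaleC_of_real: "complex_of_real r *\<^sub>C x = r *\<^sub>R x"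
    and norm_scaleC: "norm (a *\<^sub>C x) = cmod a * norm x"

instantiation complex :: complex_banach
begin

definition scaleC_complex :: "complex \<Rightarrow> complex \<Rightarrow> complex"
  where "scaleC_complex a x = a * x"

instance
  by standard
    (simp_all add: scaleC_complex_def algebra_simps norm_mult scaleR_conv_of_real)

end

text \<open>
  The notions below serve both scalar fields: \<open>smul\<close> is \<^const>\<open>scaleR\<close> or \<^const>\<open>scaleC\<close>, and
  \<open>conjg\<close> is the conjugation of the scalar field, i.e. the identity on the reals and \<^const>\<open>cnj\<close>
  on the complex numbers.
\<close>

definition bj_orthogonal :: "('k \<Rightarrow> 'a \<Rightarrow> 'a) \<Rightarrow> 'a::real_normed_vector \<Rightarrow> 'a \<Rightarrow> bool"
  where "bj_orthogonal smul x y \<longleftrightarrow> (\<forall>l. norm (x + smul l y) \<ge> norm x)"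

text \<open>
  Membership in \<open>\<real>\<^sub>\<ge>\<^sub>0\<close>, a subset of the scalar field, says that the scalar is real and nonnegative.
\<close>

definition semi_inner_product ::
  "('k \<Rightarrow> 'k) \<Rightarrow> ('k \<Rightarrow> 'v \<Rightarrow> 'v) \<Rightarrow> ('v::ab_group_add \<Rightarrow> 'v \<Rightarrow> 'k::real_normed_field) \<Rightarrow> bool"
  where "semi_inner_product conjg smul \<phi> \<longleftrightarrow>
    (\<forall>x y z a b. \<phi> (smul a x + smul b y) z = a * \<phi> x z + b * \<phi> y z) \<and>
    (\<forall>x y. \<phi> x y = conjg (\<phi> y x)) \<and>
    (\<forall>x. \<phi> x x \<in> \<real>\<^sub>\<ge>\<^sub>0)"

text \<open>
  The supremum is extended-real valued because \<open>\<phi>\<close> need not be bounded: an unbounded \<open>\<phi>\<close> has norm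
  \<open>\<infinity>\<close>, whereas the supremum of an unbounded set of reals is unspecified.  The pairs \<open>(u, v)\<close> range
  over the closed unit ball of the product space with the maximum norm.
\<close>

definition form_norm ::
  "('a::real_normed_vector \<Rightarrow> 'a \<Rightarrow> 'k::real_normed_field) \<Rightarrow> ereal"
  where "form_norm \<phi> = Sup {ereal (norm (\<phi> u v)) | u v. norm u \<le> 1 \<and> norm v \<le> 1}"

end

theory Submission imports Defs begin

text \<open>
  If \<open>x\<close> is orthogonal to \<open>y\<close>, the distance to the line through \<open>y\<close> is a seminorm with value
  \<open>\<parallel>x\<parallel>\<close> at \<open>x\<close>, so Hahn--Banach gives a linear functional \<open>f\<close> of norm one with \<open>f x = \<parallel>x\<parallel>\<close> and
  \<open>f y = 0\<close>; then \<open>\<phi> u v = f u * conj (f v)\<close> works.  Conversely,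
  \<open>\<parallel>x\<parallel>\<^sup>2 = \<phi> (x + \<lambda>y) x \<le> \<parallel>x + \<lambda>y\<parallel> \<parallel>x\<parallel>\<close>.  Hahn--Banach is obtained from the fact that the
  minimal sublinear functionals are linear, which avoids extending functionals from subspaces.
\<close>

section \<open>Sublinear functionals and the Hahn--Banach theorem\<close>

definition sublinear :: "('a::real_vector \<Rightarrow> real) \<Rightarrow> bool"
  where "sublinear p \<longleftrightarrow>
    (\<forall>u v. p (u + v) \<le> p u + p v) \<and> (\<forall>c u. 0 < c \<longrightarrow> p (c *\<^sub>R u) = c * p u)"

lemma sublinear_add: "sublinear p \<Longrightarrow> p (u + v) \<le> p u + p v"
  and sublinear_scale: "sublinear p \<Longrightarrow> 0 < c \<Longrightarrow> p (c *\<^sub>R u) = c * p u"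
  by (auto simp: sublinear_def)

lemma sublinear_0:
  assumes "sublinear p" shows "p 0 = 0"
  using sublinear_scale[OF assms, of 2 0] by simp

lemma sublinear_scale_nonneg:
  assumes "sublinear p" "0 \<le> c" shows "p (c *\<^sub>R u) = c * p u"
  using assms sublinear_scale[of p c u] sublinear_0[of p] by (cases "c = 0") auto

lemma sublinear_ge_minus:
  assumes "sublinear p" shows "- p (- u) \<le> p u"
  using sublinear_add[OF assms, of u "- u"] sublinear_0[OF assms] by simp

text \<open>The reverse inequality for \<open>c\<close> is the given one for
  \<open>inverse c\<close> at \<open>c *\<^sub>R u\<close>, so positive homogeneity only ever has to
  be checked in one direction.\<close>

lemma sublinearI:
  assumes add: "\<And>u v. p (u + v) \<le> p u + p v"
    and scale: "\<And>c u. 0 < c \<Longrightarrow> p (c *\<^sub>R u) \<le> c * p u"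
  shows "sublinear p"
  unfolding sublinear_def
proof (intro conjI allI impI)
  fix c :: real and u assume "0 < c"
  have "p u \<le> inverse c * p (c *\<^sub>R u)"
    using scale[of "inverse c" "c *\<^sub>R u"] \<open>0 < c\<close> by simp
  then have "c * p u \<le> p (c *\<^sub>R u)"
    using \<open>0 < c\<close> by (simp add: field_simps)
  with scale[OF \<open>0 < c\<close>] show "p (c *\<^sub>R u) = c * p u" by (simp add: antisym)
qed (rule add)

text \<open>
  The members of the family need not be sublinear: the conditions are only imposed on the family
  as a whole.
\<close>

lemma sublinear_INF:
  fixes F :: "'i \<Rightarrow> 'a::real_vector \<Rightarrow> real"
  assumes ne: "I \<noteq> {}"
    and bdd: "\<And>u. bdd_below ((\<lambda>i. F i u) ` I)"
    and add: "\<And>i j u v. i \<in> I \<Longrightarrow> j \<in> I \<Longrightarrow> \<exists>k\<in>I. F k (u + v) \<le> F i u + F j v"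
    and scale: "\<And>i c u. i \<in> I \<Longrightarrow> 0 < c \<Longrightarrow> \<exists>k\<in>I. F k (c *\<^sub>R u) \<le> c * F i u"
  shows "sublinear (\<lambda>u. INF i\<in>I. F i u)"
proof (rule sublinearI)
  fix u v
  let ?m = "\<lambda>u. INF i\<in>I. F i u"
  have lower: "?m u \<le> r" if "k \<in> I" "F k u \<le> r" for u k r
    using cINF_lower2[OF bdd that] .
  have *: "?m (u + v) \<le> F i u + F j v" if "i \<in> I" "j \<in> I" for i j
    using add[OF that, of u v] lower by blast
  \<comment> \<open>The infimum is taken over \<open>j\<close> with \<open>i\<close> fixed, and
    afterwards over \<open>i\<close>.\<close>
  have "?m (u + v) - F i u \<le> ?m v" if "i \<in> I" for i
    using *[OF that] by (intro cINF_greatest[OF ne]) (simp add: algebra_simps)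
  then have "?m (u + v) - ?m v \<le> ?m u"
    by (intro cINF_greatest[OF ne]) (simp add: algebra_simps)
  then show "?m (u + v) \<le> ?m u + ?m v" by simp
next
  fix c :: real and u assume c: "0 < c"
  let ?m = "\<lambda>u. INF i\<in>I. F i u"
  have "?m (c *\<^sub>R u) / c \<le> F i u" if i: "i \<in> I" for i
  proof -
    obtain k where "k \<in> I" "F k (c *\<^sub>R u) \<le> c * F i u" using scale[OF i c] by blast
    then have "?m (c *\<^sub>R u) \<le> c * F i u" by (rule cINF_lower2[OF bdd])
    then show ?thesis using c by (simp add: field_simps)
  qed
  then have "?m (c *\<^sub>R u) / c \<le> ?m u" by (rule cINF_greatest[OF ne])
  then show "?m (c *\<^sub>R u) \<le> c * ?m u" using c by (simp add: field_simps)
qed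

text \<open>Pushes \<open>p\<close> down in the direction \<open>- v\<close> as far as any linear
  minorant agreeing with \<open>p\<close> at \<open>v\<close> must go. The minorant is the infimum
  over \<open>t \<ge> 0\<close> of \<open>p (u + t *\<^sub>R v) - t * p v\<close>:
  \<open>t = 0\<close> gives \<open>r \<le> p\<close>, and \<open>t = 1\<close> gives the value at
  \<open>- v\<close>.\<close>

lemma sublinear_lower:
  assumes p: "sublinear p"
  obtains r where "sublinear r" "r \<le> p" "r (- v) \<le> - p v"
proof
  let ?F = "\<lambda>t u. p (u + t *\<^sub>R v) - t * p v"
  let ?r = "\<lambda>u. INF t\<in>{0..}. ?F t u"
  \<comment> \<open>Split \<open>t *\<^sub>R v\<close> as \<open>(u + t *\<^sub>R v) + (- u)\<close>
    and use subadditivity.\<close>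
  have lb: "- p (- u) \<le> ?F t u" if "0 \<le> t" for u t
    using sublinear_add[OF p, of "u + t *\<^sub>R v" "- u"] sublinear_scale_nonneg[OF p that] by simp
  have bdd: "bdd_below ((\<lambda>t. ?F t u) ` {0..})" for u
    by (rule bdd_belowI2[where m = "- p (- u)"]) (use lb in simp)
  show "sublinear ?r"
  proof (rule sublinear_INF[OF _ bdd])
    fix s t :: real and u w assume "s \<in> {0..}" "t \<in> {0..}"
    then show "\<exists>k\<in>{0..}. ?F k (u + w) \<le> ?F s u + ?F t w"
      using sublinear_add[OF p, of "u + s *\<^sub>R v" "w + t *\<^sub>R v"]
      by (intro bexI[of _ "s + t"]) (auto simp: algebra_simps)
  next
    fix t c :: real and u assume "t \<in> {0..}" "0 < c"
    then show "\<exists>k\<in>{0..}. ?F k (c *\<^sub>R u) \<le> c * ?F t u"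
      using sublinear_scale[OF p, of c "u + t *\<^sub>R v"]
      by (intro bexI[of _ "c * t"]) (auto simp: algebra_simps)
  qed simp
  show "?r \<le> p"
    by (rule le_funI, rule cINF_lower2[OF bdd, of 0]) auto
  show "?r (- v) \<le> - p v"
    by (rule cINF_lower2[OF bdd, of 1]) (auto simp: sublinear_0[OF p])
qed

text \<open>By minimality the lowered functional is \<open>p\<close> itself, so \<open>p\<close> is
  odd. Subadditivity at \<open>- u\<close>, \<open>- v\<close> then reverses the inequality at
  \<open>u\<close>, \<open>v\<close>.\<close>

lemma minimal_sublinear_linear:
  assumes p: "sublinear p" and min: "\<And>r. sublinear r \<Longrightarrow> r \<le> p \<Longrightarrow> r = p"
  shows "linear p"
proof -
  have "p (- v) \<le> - p v" for v
    using sublinear_lower[OF p, of v] min by metis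
  then have neg: "p (- v) = - p v" for v
    using sublinear_ge_minus[OF p, of v] by (smt (verit))
  show ?thesis
  proof (rule linearI)
    fix u v
    show "p (u + v) = p u + p v"
      using sublinear_add[OF p, of u v] sublinear_add[OF p, of "- u" "- v"] neg[of u] neg[of v]
        neg[of "u + v"] by (simp add: add.commute)
  next
    fix c :: real and u
    show "p (c *\<^sub>R u) = c *\<^sub>R p u"
      using sublinear_scale_nonneg[OF p, of c u] sublinear_scale_nonneg[OF p, of "- c" u]
        neg[of "c *\<^sub>R u"]
      by (cases "0 \<le> c") auto
  qed
qed

text \<open>Zorn's lemma for the reversed pointwise order: a nonempty chain has its pointwise
  infimum as lower bound, which is finite because every member satisfies
  \<open>- p (- u) \<le> q u\<close>.\<close>

lemma ex_minimal_sublinear: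
  assumes p: "sublinear p"
  obtains m where "sublinear m" "m \<le> p" "\<And>r. sublinear r \<Longrightarrow> r \<le> m \<Longrightarrow> r = m"
proof -
  let ?A = "{q. sublinear q \<and> q \<le> p}"
  let ?R = "relation_of (\<ge>) ?A"
  have "\<exists>m\<in>?A. \<forall>a\<in>?A. m \<ge> a \<longrightarrow> a = m"
  proof (rule predicate_Zorn)
    show "partial_order_on ?A ?R"
      by (rule partial_order_on_relation_ofI) auto
    fix C assume C: "C \<in> Chains ?R"
    show "\<exists>l\<in>?A. \<forall>a\<in>C. a \<ge> l"
    proof (cases "C = {}")
      case True then show ?thesis using p by blast
    next
      case False
      have sub: "sublinear q" "q \<le> p" if "q \<in> C" for q
        using C that by (auto simp: Chains_def relation_of_def)
      have total: "q \<le> r \<or> r \<le> q" if "q \<in> C" "r \<in> C" for q r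
        using C that by (auto simp: Chains_def relation_of_def)
      have bdd: "bdd_below ((\<lambda>q. q u) ` C)" for u
      proof (rule bdd_belowI2)
        fix q assume "q \<in> C"
        then show "- p (- u) \<le> q u"
          using sublinear_ge_minus[OF sub(1), of q u] le_funD[OF sub(2), of q "- u"] by linarith
      qed
      let ?l = "\<lambda>u. INF q\<in>C. q u"
      have le: "?l \<le> q" if "q \<in> C" for q
        by (rule le_funI, rule cINF_lower[OF bdd that])
      have "sublinear ?l"
      proof (rule sublinear_INF[OF False bdd])
        fix q r u v assume qr: "q \<in> C" "r \<in> C"
        \<comment> \<open>The smaller of \<open>q\<close> and \<open>r\<close> serves as
          \<open>k\<close>.\<close>
        from total[OF qr] show "\<exists>k\<in>C. k (u + v) \<le> q u + r v"
        proof
          assume "q \<le> r"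
          then show ?thesis
            using qr sublinear_add[OF sub(1)[OF qr(1)], of u v] le_funD[of q r v]
            by (intro bexI[of _ q]) auto
        next
          assume "r \<le> q"
          then show ?thesis
            using qr sublinear_add[OF sub(1)[OF qr(2)], of u v] le_funD[of r q u]
            by (intro bexI[of _ r]) auto
        qed
      next
        fix q u and c :: real assume "q \<in> C" "0 < c"
        then show "\<exists>k\<in>C. k (c *\<^sub>R u) \<le> c * q u"
          using sublinear_scale[OF sub(1)] by (intro bexI[of _ q]) auto
      qed
      moreover have "?l \<le> p"
        using False le sub(2) order_trans by blast
      ultimately show ?thesis using le by blast
    qed
  qed
  then obtain m where m: "sublinear m" "m \<le> p"
    and "\<And>r. sublinear r \<Longrightarrow> r \<le> p \<Longrightarrow> r \<le> m \<Longrightarrow> r = m" by auto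
  then show ?thesis using that order_trans by blast
qed

text \<open>Any linear \<open>f\<close> below the functional lowered at \<open>- x\<close> satisfies
  \<open>- f x \<le> - p x\<close>, while \<open>f \<le> p\<close> gives the other inequality; a
  minimal functional provides such an \<open>f\<close>.\<close>

theorem hahn_banach_sublinear:
  assumes p: "sublinear p"
  obtains f where "linear f" "f \<le> p" "f x = p x"
proof -
  obtain r where r: "sublinear r" "r \<le> p" "r (- x) \<le> - p x"
    using sublinear_lower[OF p] .
  obtain f where f: "sublinear f" "f \<le> r" "\<And>g. sublinear g \<Longrightarrow> g \<le> f \<Longrightarrow> g = f"
    using ex_minimal_sublinear[OF r(1)] by metis
  have lin: "linear f" by (rule minimal_sublinear_linear) (use f in auto)
  have le: "f \<le> p" using f(2) r(2) by (rule order_trans)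
  have "- f x \<le> - p x"
    using le_funD[OF f(2), of "- x"] r(3) linear_neg[OF lin, of x] by simp
  then have "f x = p x" using le_funD[OF le, of x] by simp
  with lin le show ?thesis by (rule that)
qed

text \<open>Hahn-Banach is applied to the distance from \<open>S\<close>. Allowing any real subspace
  \<open>S\<close> covers complex lines as well as real ones.\<close>

lemma norming_functional_vanishing_on:
  fixes x :: "'a::real_normed_vector"
  assumes S: "subspace S" and x: "\<And>s. s \<in> S \<Longrightarrow> norm x \<le> norm (x + s)"
  obtains f where "linear f" "\<And>u. \<bar>f u\<bar> \<le> norm u" "f x = norm x" "\<And>s. s \<in> S \<Longrightarrow> f s = 0"
proof -
  let ?q = "\<lambda>u. INF s\<in>S. norm (u + s)"
  have ne: "S \<noteq> {}" using subspace_0[OF S] by blast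
  have bdd: "bdd_below ((\<lambda>s. norm (u + s)) ` S)" for u :: 'a
    by (rule bdd_belowI2[where m = 0]) simp
  have q: "sublinear ?q"
  proof (rule sublinear_INF[OF ne bdd])
    fix s t u v :: 'a assume "s \<in> S" "t \<in> S"
    then show "\<exists>k\<in>S. norm (u + v + k) \<le> norm (u + s) + norm (v + t)"
      using norm_triangle_ineq[of "u + s" "v + t"] subspace_add[OF S]
      by (intro bexI[of _ "s + t"]) (auto simp: algebra_simps)
  next
    fix s u :: 'a and c :: real assume "s \<in> S" "0 < c"
    then show "\<exists>k\<in>S. norm (c *\<^sub>R u + k) \<le> c * norm (u + s)"
      using subspace_scale[OF S]
      by (intro bexI[of _ "c *\<^sub>R s"]) (auto simp flip: scaleR_add_right)
  qed
  obtain f where f: "linear f" "f \<le> ?q" "f x = ?q x"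
    using hahn_banach_sublinear[OF q] .
  have fle: "f u \<le> norm (u + s)" if "s \<in> S" for u s
    using le_funD[OF f(2), of u] cINF_lower[OF bdd that, of u] by linarith
  have fle_norm: "f u \<le> norm u" for u
    using fle[OF subspace_0[OF S], of u] by simp
  \<comment> \<open>Shifting \<open>s\<close> by \<open>- s\<close> makes the norm vanish; the same
    for \<open>- s\<close> later gives equality.\<close>
  have fs: "f s \<le> 0" if "s \<in> S" for s
    using fle[OF subspace_neg[OF S that], of s] by simp
  show ?thesis
  proof
    show "linear f" by fact
    show "\<bar>f u\<bar> \<le> norm u" for u
      using fle_norm[of u] fle_norm[of "- u"] linear_neg[OF f(1), of u] by simp
    show "f x = norm x"
      using cINF_greatest[OF ne, of "norm x" "\<lambda>s. norm (x + s)", OF x] fle_norm[of x] f(3) by linarith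
    show "f s = 0" if "s \<in> S" for s
      using fs[OF that] fs[OF subspace_neg[OF S that]] linear_neg[OF f(1), of s] by simp
  qed
qed

section \<open>Complex functionals\<close>

lemma scaleC_one [simp]: "1 *\<^sub>C x = (x::'a::complex_banach)"
  using scaleC_of_real[of 1 x] by simp

lemma scaleC_zero_left [simp]: "0 *\<^sub>C x = (0::'a::complex_banach)"
  using scaleC_of_real[of 0 x] by simp

lemma subspace_range_scaleC: "subspace (range (\<lambda>l. l *\<^sub>C (y::'a::complex_banach)))"
  by (rule subspaceI)
    (auto simp: image_iff scaleC_scaleC intro: exI[of _ 0]
      simp flip: scaleC_add_left scaleC_of_real)

text \<open>The real functional \<open>f\<close> is chosen to vanish on the whole complex line
  through \<open>y\<close>, and is the real part of a complex linear \<open>F\<close> with the same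
  norm bound.\<close>

lemma complex_norming_functional:
  fixes x y :: "'a::complex_banach"
  assumes "bj_orthogonal scaleC x y"
  obtains F where "\<And>u v. F (u + v) = F u + F v" "\<And>a u. F (a *\<^sub>C u) = a * F u"
    "\<And>u. cmod (F u) \<le> norm u" "F x = complex_of_real (norm x)" "F y = 0"
proof -
  obtain f where f: "linear f" "\<And>u. \<bar>f u\<bar> \<le> norm u" "f x = norm x"
    and f0: "\<And>l. f (l *\<^sub>C y) = 0"
  proof (rule norming_functional_vanishing_on[OF subspace_range_scaleC[of y], of x])
    show "norm x \<le> norm (x + s)" if "s \<in> range (\<lambda>l. l *\<^sub>C y)" for s
      using assms that by (auto simp: bj_orthogonal_def)
  qed blast
  \<comment> \<open>A complex linear \<open>F\<close> with real part \<open>f\<close> must be this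
    one, since \<open>Im (F u) = - Re (F (\<i> *\<^sub>C u))\<close>.\<close>
  define F where "F u = Complex (f u) (- f (\<i> *\<^sub>C u))" for u
  have add: "F (u + v) = F u + F v" for u v
    by (simp add: F_def complex_eq_iff scaleC_add_right linear_add[OF f(1)])
  have scale: "F (a *\<^sub>C u) = a * F u" for a u
  proof -
    have expand: "f (b *\<^sub>C u) = Re b * f u + Im b * f (\<i> *\<^sub>C u)" for b
    proof -
      have "b *\<^sub>C u = (complex_of_real (Re b) + complex_of_real (Im b) * \<i>) *\<^sub>C u"
        by (metis complex_eq mult.commute)
      then have "b *\<^sub>C u = Re b *\<^sub>R u + Im b *\<^sub>R (\<i> *\<^sub>C u)"
        by (simp add: scaleC_add_left scaleC_scaleC flip: scaleC_of_real)
      then show ?thesis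
        by (simp add: linear_add[OF f(1)] linear_scale[OF f(1)])
    qed
    show ?thesis
      \<comment> \<open>These two instances give the real and the imaginary part.\<close>
      using expand[of a] expand[of "\<i> * a"]
      by (simp add: F_def complex_eq_iff scaleC_scaleC)
  qed
  have Re_F: "Re (F u) = f u" for u by (simp add: F_def)
  have le: "cmod (F u) \<le> norm u" for u
  proof (cases "F u = 0")
    case False
    \<comment> \<open>A unimodular scalar that rotates \<open>F u\<close> onto its modulus, where
      \<open>F\<close> and its real part \<open>f\<close> agree.\<close>
    define a where "a = cnj (sgn (F u))"
    have "a * F u = complex_of_real (cmod (F u))"
      using False by (simp add: a_def sgn_eq complex_norm_square[symmetric] power2_eq_square mult.commute)
    then have "cmod (F u) = f (a *\<^sub>C u)" by (metis Re_F scale Re_complex_of_real)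
    also have "\<dots> \<le> norm (a *\<^sub>C u)" using f(2)[of "a *\<^sub>C u"] by linarith
    also have "\<dots> = norm u" using False by (simp add: norm_scaleC a_def norm_sgn)
    finally show ?thesis .
  qed simp
  have "F x = complex_of_real (norm x)"
  proof -
    \<comment> \<open>The real part is already \<open>norm x\<close>, so no room is left for an
      imaginary part.\<close>
    have "(Re (F x))\<^sup>2 + (Im (F x))\<^sup>2 \<le> (norm x)\<^sup>2"
      using power_mono[OF le[of x], of 2] by (simp add: cmod_power2)
    then show ?thesis using Re_F[of x] f(3) by (simp add: complex_eq_iff)
  qed
  moreover have "F y = 0" using f0[of 1] f0[of \<i>] by (simp add: F_def complex_eq_iff)
  ultimately show ?thesis using that add scale le by blast
qed

section \<open>Norms of forms\<close>

text \<open>The bound 1 is attained at the pair \<open>(x, x)\<close>. Comparing \<open>g\<close>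
  with \<open>f\<close> only in modulus lets \<open>g\<close> be \<open>f\<close> or its
  conjugate.\<close>

lemma form_norm_rank_one:
  fixes f g :: "'a::real_normed_vector \<Rightarrow> 'k::real_normed_field"
  assumes f: "\<And>u. norm (f u) \<le> norm u" and g: "\<And>u. norm (g u) = norm (f u)"
    and x: "norm x = 1" "norm (f x) = 1"
  shows "form_norm (\<lambda>u v. f u * g v) = 1"
  unfolding form_norm_def
proof (rule antisym)
  show "Sup {ereal (norm (f u * g v)) |u v. norm u \<le> 1 \<and> norm v \<le> 1} \<le> 1"
    using g by (auto intro!: Sup_least mult_le_one order_trans[OF f] simp: norm_mult)
  show "1 \<le> Sup {ereal (norm (f u * g v)) |u v. norm u \<le> 1 \<and> norm v \<le> 1}"
    by (rule Sup_upper) (use x g in \<open>auto simp: norm_mult intro!: exI[of _ x]\<close>)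
qed

lemma form_norm_bound:
  assumes "form_norm \<phi> = 1" "norm u \<le> 1" "norm v \<le> 1"
  shows "norm (\<phi> u v) \<le> 1"
proof -
  have "ereal (norm (\<phi> u v)) \<le> form_norm \<phi>"
    unfolding form_norm_def using assms by (auto intro: Sup_upper)
  then show ?thesis using assms by simp
qed

text \<open>
  The scalar multiplication is compared with \<^const>\<open>scaleR\<close> through \<^const>\<open>of_real\<close>, so that the
  real and the complex case are treated at once.
\<close>

lemma semi_inner_product_imp_bj_orthogonal:
  fixes x y :: "'a::real_normed_vector" and \<phi> :: "'a \<Rightarrow> 'a \<Rightarrow> 'k::real_normed_field"
  assumes smul: "\<And>r u. smul (of_real r) u = r *\<^sub>R u"
    and conjg: "\<And>r. conjg (of_real r) = of_real r" "\<And>a b. conjg (a * b) = conjg a * conjg b"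
    and \<phi>: "semi_inner_product conjg smul \<phi>" "form_norm \<phi> = 1"
    and xx: "\<phi> x x = of_real ((norm x)\<^sup>2)" and xy: "\<phi> x y = 0"
  shows "bj_orthogonal smul x y"
  unfolding bj_orthogonal_def
proof
  fix l
  have lin: "\<phi> (smul a u + smul b v) w = a * \<phi> u w + b * \<phi> v w"
    and sym: "\<phi> u v = conjg (\<phi> v u)" for a b u v w
    using \<phi>(1) unfolding semi_inner_product_def by blast+
  have sc1: "\<phi> (r *\<^sub>R u) w = of_real r * \<phi> u w" for r u w
    using lin[of "of_real r" u 0 u w] smul[of 0 u] smul[of r u] by simp
  have sc2: "\<phi> w (r *\<^sub>R u) = of_real r * \<phi> w u" for r u w
    by (metis sym sc1 conjg)
  have bound: "norm (\<phi> u v) \<le> norm u * norm v" for u v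
  proof (cases "u = 0 \<or> v = 0")
    case True
    then show ?thesis using sc1[of 0 u v] sc2[of u 0 v] by auto
  next
    case False
    then show ?thesis
      using form_norm_bound[OF \<phi>(2), of "inverse (norm u) *\<^sub>R u" "inverse (norm v) *\<^sub>R v"]
      by (simp add: sc1 sc2 norm_mult norm_divide field_simps)
  qed
  \<comment> \<open>The form is linear in its first argument, so the orthogonality is moved there by
    symmetry.\<close>
  have "\<phi> y x = 0" using sym[of y x] xy conjg(1)[of 0] by simp
  then have "\<phi> (x + smul l y) x = of_real ((norm x)\<^sup>2)"
    using lin[of 1 x l y x] smul[of 1 x] xx by simp
  then have "norm x * norm x \<le> norm (x + smul l y) * norm x"
    using bound[of "x + smul l y" x] by (simp add: power2_eq_square norm_mult)
  then show "norm x \<le> norm (x + smul l y)"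
    by (cases "x = 0") auto
qed

section \<open>The characterization of orthogonality\<close>

lemma bj_orthogonal_real_iff:
  fixes x y :: "'a::real_normed_vector"
  assumes "x \<noteq> 0"
  shows "bj_orthogonal scaleR x y \<longleftrightarrow>
    (\<exists>\<phi> :: 'a \<Rightarrow> 'a \<Rightarrow> real. semi_inner_product (\<lambda>a. a) scaleR \<phi> \<and> form_norm \<phi> = 1 \<and>
      \<phi> x x = (norm x)\<^sup>2 \<and> \<phi> x y = 0)" (is "_ \<longleftrightarrow> ?R")
proof
  assume orth: "bj_orthogonal scaleR x y"
  obtain f where f: "linear f" "\<And>u. \<bar>f u\<bar> \<le> norm u" "f x = norm x" and fy: "f y = 0"
  proof (rule norming_functional_vanishing_on[OF subspace_span[of "{y}"], of x])
    show "norm x \<le> norm (x + s)" if "s \<in> span {y}" for s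
      using orth that by (auto simp: bj_orthogonal_def span_singleton)
  qed (metis span_base singletonI)
  have "semi_inner_product (\<lambda>a. a) scaleR (\<lambda>u v. f u * f v)"
    by (auto simp: semi_inner_product_def linear_add[OF f(1)] linear_scale[OF f(1)]
        algebra_simps nonneg_Reals_def)
  moreover have "form_norm (\<lambda>u v. f u * f v) = 1"
    \<comment> \<open>The norm is attained at the normalized \<open>x\<close>, where
      \<open>f\<close> has value 1.\<close>
    by (rule form_norm_rank_one[where x = "inverse (norm x) *\<^sub>R x"])
      (use assms f linear_scale[OF f(1)] in auto)
  ultimately show ?R using f(3) fy by (auto simp: power2_eq_square)
next
  assume ?R
  then show "bj_orthogonal scaleR x y"
    by (auto intro: semi_inner_product_imp_bj_orthogonal[where conjg = "\<lambda>a. a"])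
qed

lemma bj_orthogonal_complex_iff:
  fixes x y :: "'a::complex_banach"
  assumes "x \<noteq> 0"
  shows "bj_orthogonal scaleC x y \<longleftrightarrow>
    (\<exists>\<phi> :: 'a \<Rightarrow> 'a \<Rightarrow> complex. semi_inner_product cnj scaleC \<phi> \<and> form_norm \<phi> = 1 \<and>
      \<phi> x x = complex_of_real ((norm x)\<^sup>2) \<and> \<phi> x y = 0)" (is "_ \<longleftrightarrow> ?R")
proof
  assume "bj_orthogonal scaleC x y"
  then obtain F where F: "\<And>u v. F (u + v) = F u + F v" "\<And>a u. F (a *\<^sub>C u) = a * F u"
    "\<And>u. cmod (F u) \<le> norm u" "F x = complex_of_real (norm x)" "F y = 0"
    using complex_norming_functional by blast
  have "F u * cnj (F u) \<in> \<real>\<^sub>\<ge>\<^sub>0" for u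
    by (simp add: complex_nonneg_Reals_iff)
  then have "semi_inner_product cnj scaleC (\<lambda>u v. F u * cnj (F v))"
    by (simp add: semi_inner_product_def F(1,2) algebra_simps)
  moreover have "form_norm (\<lambda>u v. F u * cnj (F v)) = 1"
  proof (rule form_norm_rank_one[where x = "inverse (norm x) *\<^sub>R x"])
    \<comment> \<open>The real factor is read as a complex one, since homogeneity of
      \<open>F\<close> is stated for \<open>scaleC\<close>.\<close>
    show "norm (F (inverse (norm x) *\<^sub>R x)) = 1"
      using assms F(2)[of "of_real (inverse (norm x))" x] F(4)
      by (simp only: scaleC_of_real) (simp add: norm_mult norm_inverse)
  qed (use assms F(3) in auto)
  ultimately show ?R using F(4,5) by (auto simp: power2_eq_square intro!: exI)
next
  assume ?R
  then show "bj_orthogonal scaleC x y"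
    by (auto intro: semi_inner_product_imp_bj_orthogonal[where conjg = cnj] simp: scaleC_of_real)
qed

theorem theorem1p2:
  "(\<forall>x y :: 'a::banach. x \<noteq> 0 \<longrightarrow>
      (bj_orthogonal scaleR x y \<longleftrightarrow>
        (\<exists>\<phi> :: 'a \<Rightarrow> 'a \<Rightarrow> real.
          semi_inner_product (\<lambda>a. a) scaleR \<phi> \<and> form_norm \<phi> = 1 \<and>
          \<phi> x x = (norm x)\<^sup>2 \<and> \<phi> x y = 0)))
   \<and>
   (\<forall>x y :: 'b::complex_banach. x \<noteq> 0 \<longrightarrow>
      (bj_orthogonal scaleC x y \<longleftrightarrow>
        (\<exists>\<phi> :: 'b \<Rightarrow> 'b \<Rightarrow> complex.
          semi_inner_product cnj scaleC \<phi> \<and> form_norm \<phi> = 1 \<and>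
          \<phi> x x = complex_of_real ((norm x)\<^sup>2) \<and> \<phi> x y = 0)))"
  by (intro conjI allI impI bj_orthogonal_real_iff bj_orthogonal_complex_iff)

end
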